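(* Let $E$ be the elliptic curve over $\mathbb{Q}$ given by $y^2=x^3+ax+b$ with $b\neq 0$, let $P=(z,w)\in E(\mathbb{Q})\setminus\{\mathcal{O}\}$, let $d=4a^3+27b^2$ and $\Delta=-16d$. Let $$g=x^4-4\Delta x-12a\Delta,$$ $$h_1=x^4-512dx^2+2^{15}dw^2x+2^{16}d\big(d+w^2(12az-36b)\big)+2^{18}d\big(27bz^3-9a^2z^2-a^3\big).$$ Let $k_g/\mathbb{Q}$ be the extension obtained by adjoining a root $\alpha$ of $g$ to $\mathbb{Q}$, and let $k_1/\mathbb{Q}$ be the extension obtained by adjoining a root of $h_1$ to $\mathbb{Q}$. Put $$\beta=\frac{-1}{3^2b}\Big(\alpha^3-4a\alpha^2+(8a^2-72bz)\alpha+2^4\cdot 3\, d\Big).$$ Then $\beta$ is a root of $h_1$, and the map $\alpha\mapsto\beta$ gives an isomorphism between $k_g$ and $k_1$.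
   Context: $\mathcal{O}$ is the point at infinity of $E$. The field $k_g$ depends only on $E$ (when $\overline{\rho}_{E,4}$ is surjective, $g$ cuts out the unique $S_4$-quotient of the $\mathrm{GL}_2(\mathbb{Z}/4\mathbb{Z})$-extension $\mathbb{Q}(E[4])/\mathbb{Q}$), while $k_1$ and the isomorphism depend on the point $P$.
   Formalization: The coefficient 8a² in β is corrected to 16a² (as printed, β is not a root of h_1 for a=1, b=-1, P=(2,3)), and the isomorphism is claimed only for g irreducible over Q (it fails for a=0, b=4, P=(0,2), where β=192); that β is a root of h_1 is claimed for every g. *)

theory Defs
  imports
    "HOL-Computational_Algebra.Computational_Algebra"
    "HOL-Algebra.Generated_Fields"
    "HOL-Algebra.Algebraic_Closure_Type"
begin

section \<open>The curve \<open>y\<^sup>2 = x\<^sup>3 + a x + b\<close> over the rationals\<close>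

definition curve_d :: "rat \<Rightarrow> rat \<Rightarrow> rat" where
  "curve_d a b = 4 * a ^ 3 + 27 * b ^ 2"

definition curve_Delta :: "rat \<Rightarrow> rat \<Rightarrow> rat" where
  "curve_Delta a b = - 16 * curve_d a b"

definition is_elliptic_curve :: "rat \<Rightarrow> rat \<Rightarrow> bool" where
  "is_elliptic_curve a b \<longleftrightarrow> curve_Delta a b \<noteq> 0"

text \<open>\<open>None\<close> is the point at infinity.\<close>

definition rational_points :: "rat \<Rightarrow> rat \<Rightarrow> (rat \<times> rat) option set" where
  "rational_points a b =
     insert None (Some ` {(x, y). y ^ 2 = x ^ 3 + a * x + b})"

section \<open>The two quartics and the element \<open>\<beta>\<close>\<close>

definition g_poly :: "rat \<Rightarrow> rat \<Rightarrow> rat poly" where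
  "g_poly a b = [: - 12 * a * curve_Delta a b, - 4 * curve_Delta a b, 0, 0, 1 :]"

text \<open>
  When \<open>g\<close> is reducible, the field obtained by adjoining a root \<open>\<alpha>\<close> depends on the root, and \<open>\<beta>\<close> need
  not generate it: for \<open>a = 0\<close>, \<open>b = w\<^sup>2\<close>, \<open>z = 0\<close> and \<open>\<alpha>\<^sup>3 = -1728 w\<^sup>4\<close> one gets \<open>\<beta> = 48 b\<close>.
\<close>

definition h1_poly :: "rat \<Rightarrow> rat \<Rightarrow> rat \<Rightarrow> rat \<Rightarrow> rat poly" where
  "h1_poly a b z w = (let d = curve_d a b in
     [: 2 ^ 16 * d * (d + w ^ 2 * (12 * a * z - 36 * b))
          + 2 ^ 18 * d * (27 * b * z ^ 3 - 9 * a ^ 2 * z ^ 2 - a ^ 3),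
        2 ^ 15 * d * w ^ 2,
        - 512 * d,
        0,
        1 :])"

text \<open>
  The coefficient of \<open>\<alpha>\<close> has to be \<open>16 a\<^sup>2 - 72 b z\<close>. With \<open>8 a\<^sup>2\<close> in place of \<open>16 a\<^sup>2\<close>, \<open>\<beta>\<close> is in
  general not a root of \<open>h\<^sub>1\<close>, for instance for \<open>a = 1\<close>, \<open>b = -1\<close>, \<open>(z, w) = (2, 3)\<close>.
\<close>

definition beta_of :: "rat \<Rightarrow> rat \<Rightarrow> rat \<Rightarrow> 'k::field_char_0 \<Rightarrow> 'k" where
  "beta_of a b z \<alpha> =
     of_rat (- 1 / (3 ^ 2 * b)) *
       (\<alpha> ^ 3 - of_rat (4 * a) * \<alpha> ^ 2 + of_rat (16 * a ^ 2 - 72 * b * z) * \<alpha>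
          + of_rat (2 ^ 4 * 3 * curve_d a b))"

section \<open>Adjoining an element to the rationals\<close>

definition rat_root :: "rat poly \<Rightarrow> 'k::field_char_0 \<Rightarrow> bool" where
  "rat_root p x \<longleftrightarrow> poly (map_poly of_rat p) x = 0"

text \<open>
  In characteristic 0 the subfield generated by \<open>{x}\<close> contains the rationals, and every ring
  homomorphism between such subfields is \<open>\<rat>\<close>-linear.
\<close>

definition rat_adjoin :: "'k::field_char_0 \<Rightarrow> 'k ring" where
  "rat_adjoin x =
     ring_of_type_algebra\<lparr>carrier := generate_field ring_of_type_algebra {x}\<rparr>"

end

(* That \<beta> is a root of h1 is a polynomial identity modulo g and the equation of the curve.
   If g is irreducible, \<alpha> can be written as a quotient of a quadratic by a linear polynomial in \<beta>
   with explicit rational coefficients; the denominator s + t y is nonzero because 1, \<alpha>, \<alpha>^2, \<alpha>^3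
   are independent and s = t = 0 would force a = 0 (g has the root 0) or d = 0.
   So \<alpha> and \<beta> generate the same field.  A rational polynomial of degree below 4 killing \<beta> would
   bound the dimension of this field and hence yield one killing \<alpha>, so h1 is irreducible, and every
   root of h1 generates a copy of the field. *)
theory Submission
  imports Defs
begin

section \<open>Evaluation of rational polynomials at a fixed element\<close>

text \<open>With \<open>x\<close> fixed this is a ring homomorphism from Q[T], so
  \<open>range (rat_eval x)\<close> is the ring Q[x].\<close>

definition rat_eval :: "'k::field_char_0 \<Rightarrow> rat poly \<Rightarrow> 'k" where
  "rat_eval x p = poly (map_poly of_rat p) x"

lemma rat_root_iff: "rat_root p x \<longleftrightarrow> rat_eval x p = 0"
  by (simp add: rat_root_def rat_eval_def)

lemma rat_eval_0 [simp]: "rat_eval x 0 = 0"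
  by (simp add: rat_eval_def)

lemma rat_eval_pCons [simp]: "rat_eval x (pCons c p) = of_rat c + x * rat_eval x p"
  by (cases "pCons c p = 0") (auto simp: rat_eval_def map_poly_pCons)

lemma rat_eval_1 [simp]: "rat_eval x 1 = 1"
  by (simp add: one_pCons)

lemma rat_eval_add [simp]: "rat_eval x (p + q) = rat_eval x p + rat_eval x q"
proof (induction p arbitrary: q)
  case (pCons c p)
  then show ?case by (cases q) (simp add: of_rat_add algebra_simps)
qed simp

lemma rat_eval_smult [simp]: "rat_eval x (smult c p) = of_rat c * rat_eval x p"
  by (induction p) (simp_all add: of_rat_mult algebra_simps)

lemma rat_eval_minus [simp]: "rat_eval x (- p) = - rat_eval x p"
  by (induction p) (simp_all add: of_rat_minus)

lemma rat_eval_diff [simp]: "rat_eval x (p - q) = rat_eval x p - rat_eval x q"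
  using rat_eval_add[of x p "- q"] by simp

lemma rat_eval_mult [simp]: "rat_eval x (p * q) = rat_eval x p * rat_eval x q"
  by (induction p) (simp_all add: algebra_simps)

lemma rat_eval_power [simp]: "rat_eval x (p ^ n) = rat_eval x p ^ n"
  by (induction n) simp_all

lemma rat_eval_monom [simp]: "rat_eval x (monom c n) = of_rat c * x ^ n"
  by (induction n) (simp_all add: monom_0 monom_Suc)

lemma rat_eval_sum [simp]: "rat_eval x (sum f A) = (\<Sum>i\<in>A. rat_eval x (f i))"
  by (induction A rule: infinite_finite_induct) simp_all

lemma rat_eval_altdef: "rat_eval x p = (\<Sum>i\<le>degree p. of_rat (coeff p i) * x ^ i)"
  using rat_eval_sum[of x "\<lambda>i. monom (coeff p i) i" "{..degree p}"]
  by (simp add: poly_as_sum_of_monoms)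

text \<open>If y = q(x), then p(y) is the composition of p with q, evaluated at x. Used in both
  directions, this gives Q[\<alpha>] = Q[\<beta>].\<close>

lemma range_rat_eval_subset:
  assumes "y \<in> range (rat_eval x)"
  shows "range (rat_eval y) \<subseteq> range (rat_eval x)"
proof -
  obtain q where q: "y = rat_eval x q" using assms by blast
  have "rat_eval y p = rat_eval x (pcompose p q)" for p
    by (induction p) (simp_all add: pcompose_pCons q)
  then show ?thesis by auto
qed

lemma rat_eval_mod:
  assumes "rat_eval x f = 0"
  shows "rat_eval x (p mod f) = rat_eval x p"
proof -
  have "rat_eval x p = rat_eval x (p div f * f + p mod f)"
    by simp
  also have "\<dots> = rat_eval x (p mod f)"
    using assms by (simp only: rat_eval_add rat_eval_mult) simp
  finally show ?thesis by simp
qed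

section \<open>Irreducible polynomials and degree bounds\<close>

text \<open>Up to a scalar, \<open>f\<close> is the minimal polynomial of \<open>x\<close>: if it
  did not divide \<open>p\<close>, a Bezout relation r f + s p = 1 evaluated at \<open>x\<close>
  would read 0 = 1.\<close>

lemma rat_eval_eq_0_iff_dvd:
  assumes "Factorial_Ring.irreducible f" "rat_eval x f = 0"
  shows "rat_eval x p = 0 \<longleftrightarrow> f dvd p"
proof
  assume p: "rat_eval x p = 0"
  show "f dvd p"
  proof (rule ccontr)
    assume "\<not> f dvd p"
    then have "coprime f p"
      using assms(1) by (simp add: irreducible_imp_prime_elem_gcd prime_elem_imp_coprime)
    then obtain r s where "r * f + s * p = 1"
      by (metis bezout_coefficients_fst_snd coprime_imp_gcd_eq_1)
    then have "rat_eval x (r * f + s * p) = 1" by simp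
    with p assms(2) show False by simp
  qed
next
  assume "f dvd p"
  with assms(2) show "rat_eval x p = 0" by (auto elim!: dvdE)
qed

text \<open>The same Bezout relation exhibits s(x) as the inverse of p(x), so Q[x] is a
  field.\<close>

lemma inverse_rat_eval:
  assumes "Factorial_Ring.irreducible f" "rat_eval x f = 0"
  shows "inverse (rat_eval x p) \<in> range (rat_eval x)"
proof (cases "rat_eval x p = 0")
  case True
  \<comment> \<open>Here the inverse is the default value \<open>inverse 0 = 0\<close>, the value of
    the zero polynomial.\<close>
  then show ?thesis by (metis inverse_zero rangeI rat_eval_0)
next
  case False
  then have "coprime f p"
    using assms rat_eval_eq_0_iff_dvd[OF assms]
    by (simp add: irreducible_imp_prime_elem_gcd prime_elem_imp_coprime)
  then obtain r s where "r * f + s * p = 1"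
    by (metis bezout_coefficients_fst_snd coprime_imp_gcd_eq_1)
  then have "rat_eval x (r * f + s * p) = 1" by simp
  with assms(2) have "rat_eval x s * rat_eval x p = 1" by simp
  then have "inverse (rat_eval x p) = rat_eval x s"
    by (metis inverse_unique mult.commute)
  then show ?thesis by simp
qed

lemma rat_eval_divide_in_range:
  assumes "Factorial_Ring.irreducible f" "rat_eval x f = 0"
  shows "rat_eval x p / rat_eval x q \<in> range (rat_eval x)"
proof -
  obtain r where "inverse (rat_eval x q) = rat_eval x r"
    using inverse_rat_eval[OF assms, of q] by blast
  then have "rat_eval x p / rat_eval x q = rat_eval x (p * r)"
    by (simp add: divide_inverse)
  then show ?thesis by (simp only: rangeI)
qed

text \<open>Induction on the degree: in a factorisation into non-units both factors have smaller
  degree, and one of them vanishes at \<open>x\<close> because the field has no zero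
  divisors.\<close>

lemma ex_irreducible_rat_eval_eq_0:
  assumes "f \<noteq> 0" "rat_eval x f = 0"
  shows "\<exists>m. Factorial_Ring.irreducible m \<and> rat_eval x m = 0 \<and> degree m \<le> degree f"
  using assms
proof (induction "degree f" arbitrary: f rule: less_induct)
  case less
  show ?case
  proof (cases "Factorial_Ring.irreducible f")
    case True
    with less.prems show ?thesis by blast
  next
    case False
    have "\<not> f dvd 1"
    proof
      assume "f dvd 1"
      then obtain g where "f * g = 1" by (metis dvdE)
      then have "rat_eval x (f * g) = 1" by simp
      with less.prems show False by simp
    qed
    with False less.prems(1) obtain p q where pq: "f = p * q" "\<not> p dvd 1" "\<not> q dvd 1"
      unfolding Factorial_Ring.irreducible_def by blast
    with less.prems(1) have "p \<noteq> 0" "q \<noteq> 0" by auto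
    with pq have deg: "degree p < degree f" "degree q < degree f"
      by (simp_all add: degree_mult_eq is_unit_iff_degree)
    from less.prems(2) pq have "rat_eval x p = 0 \<or> rat_eval x q = 0" by simp
    with less.hyps deg \<open>p \<noteq> 0\<close> \<open>q \<noteq> 0\<close> show ?thesis
      by (meson less_imp_le order_trans)
  qed
qed

text \<open>As a rational vector space Q[x] is spanned by n = deg f powers of x, so the n + 1 powers
  1, y, ..., y^n satisfy a linear relation.\<close>

lemma ex_rat_eval_eq_0_degree_le:
  assumes "f \<noteq> 0" "rat_eval x f = 0" "y \<in> range (rat_eval x)"
  shows "\<exists>q. q \<noteq> 0 \<and> rat_eval y q = 0 \<and> degree q \<le> degree f"
proof -
  interpret V: vector_space "\<lambda>(r::rat) (v::'a). of_rat r * v"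
    by unfold_locales (simp_all add: of_rat_add of_rat_mult algebra_simps)
  define n where "n = degree f"
  define T where "T = (\<lambda>i. x ^ i) ` {..<n}"
  have T: "finite T" "card T \<le> n"
    unfolding T_def by (auto intro: card_image_le[of "{..<n}", simplified])
  have span: "rat_eval x p \<in> V.span T" for p
  proof (cases "p mod f = 0")
    case True
    then show ?thesis
      using rat_eval_mod[OF assms(2), of p] by (simp add: V.span_zero)
  next
    case False
    then have "degree (p mod f) < n"
      using degree_mod_less[OF assms(1), of p] by (simp add: n_def)
    then have "(\<Sum>i\<le>degree (p mod f). of_rat (coeff (p mod f) i) * x ^ i) \<in> V.span T"
      by (intro V.span_sum V.span_scale V.span_base) (auto simp: T_def)
    then show ?thesis
      using rat_eval_mod[OF assms(2), of p] by (simp add: rat_eval_altdef[of x "p mod f"])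
  qed
  from assms(3) obtain p where y: "y = rat_eval x p" by blast
  show ?thesis
  \<comment> \<open>Dependence is a notion for sets of vectors, so coinciding powers of
    \<open>y\<close> are treated separately; they give the relation y^i = y^j directly.\<close>
  proof (cases "inj_on (\<lambda>i. y ^ i) {..n}")
    case False
    then obtain i j where ij: "i \<le> n" "j \<le> n" "i \<noteq> j" "y ^ i = y ^ j"
      by (auto simp: inj_on_def)
    let ?q = "monom 1 i - monom 1 j :: rat poly"
    have "coeff ?q i = 1" using ij by simp
    then have "?q \<noteq> 0" by (metis coeff_0 zero_neq_one)
    moreover have "degree ?q \<le> n"
      using ij by (intro degree_diff_le) (simp_all add: degree_monom_eq)
    ultimately show ?thesis using ij by (intro exI[of _ ?q]) (auto simp: n_def)
  next
    case True
    let ?S = "(\<lambda>i. y ^ i) ` {..n}"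
    have "?S \<subseteq> V.span T"
      unfolding y using span[of "p ^ _"] by auto
    moreover have "card ?S = Suc n" using True by (simp add: card_image)
    ultimately have "V.dependent ?S"
      using V.independent_span_bound[of T ?S] T by fastforce
    then obtain u k where u: "k \<le> n" "u (y ^ k) \<noteq> 0" "(\<Sum>v\<in>?S. of_rat (u v) * v) = 0"
      by (auto simp: V.dependent_finite)
    \<comment> \<open>The coefficients \<open>u\<close> are indexed by vectors; injectivity of the
      powers turns them into coefficients indexed by exponents.\<close>
    let ?q = "\<Sum>i\<le>n. monom (u (y ^ i)) i"
    have "rat_eval y ?q = 0"
      using u(3) True by (simp add: sum.reindex)
    moreover have "coeff ?q k \<noteq> 0"
      using u by (simp add: coeff_sum)
    then have "?q \<noteq> 0" by (metis coeff_0)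
    moreover have "degree ?q \<le> n"
      by (intro degree_sum_le) (auto intro: order_trans[OF degree_monom_le])
    ultimately show ?thesis by (auto simp: n_def)
  qed
qed

section \<open>The subfield generated by one element\<close>

abbreviation type_ring :: "'k::field_char_0 ring" where
  "type_ring \<equiv> ring_of_type_algebra"

lemma type_ring_simps [simp]:
  "carrier type_ring = UNIV"
  "x \<otimes>\<^bsub>type_ring\<^esub> y = x * y"
  "x \<oplus>\<^bsub>type_ring\<^esub> y = x + y"
  "\<one>\<^bsub>type_ring\<^esub> = 1"
  "\<zero>\<^bsub>type_ring\<^esub> = 0"
  by (simp_all add: ring_of_type_algebra_def)

lemma type_ring_a_inv [simp]: "\<ominus>\<^bsub>type_ring\<^esub> x = - x"
proof -
  interpret field type_ring by (rule field_from_type_algebra)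
  show ?thesis using minus_equality[of "- x" x] by simp
qed

lemma type_ring_m_inv [simp]:
  assumes "x \<noteq> 0"
  shows "inv\<^bsub>type_ring\<^esub> x = inverse x"
proof -
  interpret field type_ring by (rule field_from_type_algebra)
  show ?thesis using inv_unique'[of x "inverse x"] assms by simp
qed

text \<open>A subfield contains 1, hence all integers by sums and negation, hence all their
  quotients.\<close>

lemma of_rat_in_generate_field: "of_rat r \<in> generate_field type_ring H"
proof -
  let ?F = "generate_field type_ring H"
  have one: "1 \<in> ?F" using generate_field.one[of type_ring H] by simp
  have neg: "- u \<in> ?F" if "u \<in> ?F" for u
    using generate_field.a_inv[OF that] by simp
  have add: "u + v \<in> ?F" if "u \<in> ?F" "v \<in> ?F" for u v
    using generate_field.eng_add[OF that] by simp
  have nat: "of_nat n \<in> ?F" for n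
  proof (induction n)
    case 0
    show ?case using add[OF one neg[OF one]] by simp
  next
    case (Suc n)
    then show ?case using add[OF one] by simp
  qed
  have int: "of_int k \<in> ?F" for k
    by (cases k rule: int_cases2) (auto intro: nat neg)
  obtain k l where r: "r = Rat.Fract k l" "l > 0" by (cases r) auto
  have "inverse (of_int l) \<in> ?F"
    using generate_field.m_inv[OF int[of l]] r(2) by simp
  then have "of_int k * inverse (of_int l) \<in> ?F"
    using generate_field.eng_mult[OF int[of k]] by fastforce
  then show ?thesis
    using r by (simp add: of_rat_rat divide_inverse)
qed

text \<open>Since \<open>f\<close> is irreducible, Q[x] is closed under inverses and is already the
  generated subfield.\<close>

lemma carrier_rat_adjoin:
  assumes "Factorial_Ring.irreducible f" "rat_eval x f = 0"
  shows "carrier (rat_adjoin x) = range (rat_eval x)"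
proof -
  let ?F = "generate_field type_ring {x}"
  have "rat_eval x p \<in> ?F" for p
  proof (induction p)
    case 0
    show ?case using of_rat_in_generate_field[of 0] by simp
  next
    case (pCons c p)
    have "x * rat_eval x p \<in> ?F"
      using generate_field.eng_mult[OF generate_field.incl pCons.IH, of x] by simp
    then show ?case
      using generate_field.eng_add[OF of_rat_in_generate_field[of c]] by fastforce
  qed
  moreover have "v \<in> range (rat_eval x)" if "v \<in> ?F" for v
    using that
  proof (induction rule: generate_field.induct)
    case one
    show ?case using rat_eval_1[of x] by (metis rangeI type_ring_simps(4))
  next
    case (incl h)
    then show ?case using rangeI[of "rat_eval x" "[:0, 1:]"] by simp
  next
    case (a_inv h)
    then show ?case by (auto simp flip: rat_eval_minus)
  next
    case (m_inv h)
    then show ?case using inverse_rat_eval[OF assms] by auto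
  next
    case (eng_add u v)
    then show ?case by (auto simp flip: rat_eval_add)
  next
    case (eng_mult u v)
    then show ?case by (auto simp flip: rat_eval_mult)
  qed
  ultimately show ?thesis by (auto simp: rat_adjoin_def)
qed

text \<open>Both evaluations have kernel (f), so both fields are copies of Q[T]/(f), and p(x) can be
  sent to p(y).\<close>

lemma rat_adjoin_iso:
  fixes x :: "'k::field_char_0" and y :: "'l::field_char_0"
  assumes f: "Factorial_Ring.irreducible f" and x: "rat_eval x f = 0" and y: "rat_eval y f = 0"
  shows "\<exists>\<phi> \<in> ring_iso (rat_adjoin x) (rat_adjoin y). \<phi> x = y"
proof -
  have eq: "rat_eval x p = rat_eval x q \<longleftrightarrow> rat_eval y p = rat_eval y q" for p q
    using rat_eval_eq_0_iff_dvd[OF f x, of "p - q"] rat_eval_eq_0_iff_dvd[OF f y, of "p - q"] by simp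
  \<comment> \<open>An arbitrary polynomial representing \<open>v\<close> is chosen; by
    \<open>eq\<close> its value at \<open>y\<close> does not depend on the choice.\<close>
  define \<phi> where "\<phi> v = rat_eval y (inv_into UNIV (rat_eval x) v)" for v :: 'k
  have \<phi>: "\<phi> (rat_eval x p) = rat_eval y p" for p
    unfolding \<phi>_def using eq by (metis f_inv_into_f rangeI)
  have "\<phi> \<in> ring_hom (rat_adjoin x) (rat_adjoin y)"
  proof (rule ring_hom_memI)
    fix u v
    assume "u \<in> carrier (rat_adjoin x)" "v \<in> carrier (rat_adjoin x)"
    then obtain p q where [simp]: "u = rat_eval x p" "v = rat_eval x q"
      unfolding carrier_rat_adjoin[OF f x] by blast
    show "\<phi> u \<in> carrier (rat_adjoin y)"
      by (simp add: carrier_rat_adjoin[OF f y] \<phi>)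
    show "\<phi> (u \<otimes>\<^bsub>rat_adjoin x\<^esub> v) = \<phi> u \<otimes>\<^bsub>rat_adjoin y\<^esub> \<phi> v"
      using \<phi>[of "p * q"] by (simp add: rat_adjoin_def \<phi>)
    show "\<phi> (u \<oplus>\<^bsub>rat_adjoin x\<^esub> v) = \<phi> u \<oplus>\<^bsub>rat_adjoin y\<^esub> \<phi> v"
      using \<phi>[of "p + q"] by (simp add: rat_adjoin_def \<phi>)
  next
    show "\<phi> \<one>\<^bsub>rat_adjoin x\<^esub> = \<one>\<^bsub>rat_adjoin y\<^esub>"
      using \<phi>[of 1] by (simp add: rat_adjoin_def)
  qed
  moreover have "bij_betw \<phi> (carrier (rat_adjoin x)) (carrier (rat_adjoin y))"
    unfolding bij_betw_def inj_on_def carrier_rat_adjoin[OF f x] carrier_rat_adjoin[OF f y]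
    by (auto simp: \<phi> eq image_image)
  moreover have "\<phi> x = y"
    using \<phi>[of "[:0, 1:]"] by simp
  ultimately show ?thesis by (auto simp: ring_iso_def)
qed

section \<open>Polynomial identities modulo the quartic\<close>

text \<open>Reduction of a square to degree below 4. Two applications reduce a fourth power while
  keeping the coefficients short.\<close>

lemma quartic_square:
  fixes x :: "'a::comm_ring_1"
  assumes "x ^ 4 = u * x + v"
  shows "(c0 + c1 * x + c2 * x ^ 2 + c3 * x ^ 3) ^ 2 =
    (c0 ^ 2 + v * (c2 ^ 2 + 2 * c1 * c3))
    + (2 * c0 * c1 + u * (c2 ^ 2 + 2 * c1 * c3) + v * 2 * c2 * c3) * x
    + (c1 ^ 2 + 2 * c0 * c2 + u * 2 * c2 * c3 + v * c3 ^ 2) * x ^ 2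
    + (2 * c0 * c3 + 2 * c1 * c2 + u * c3 ^ 2) * x ^ 3"
proof -
  have "(c0 + c1 * x + c2 * x ^ 2 + c3 * x ^ 3) ^ 2 =
      c0 ^ 2 + 2 * c0 * c1 * x + (c1 ^ 2 + 2 * c0 * c2) * x ^ 2 + (2 * c0 * c3 + 2 * c1 * c2) * x ^ 3
      + (c2 ^ 2 + 2 * c1 * c3 + 2 * c2 * c3 * x + c3 ^ 2 * x ^ 2) * x ^ 4"
    by (simp add: algebra_simps eval_nat_numeral)
  then show ?thesis
    unfolding assms by (simp add: algebra_simps eval_nat_numeral)
qed

text \<open>The factor \<open>(9 * b) ^ 4\<close> clears the denominators of \<beta>. What remains
  is a polynomial in T = -9 b y; reduced to degree at most 3 in \<open>x\<close>, its four
  coefficients vanish by the curve equation and the formula for \<open>d\<close>.\<close>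

lemma h1_identity:
  fixes a b z d w x :: "'a::field_char_0"
  assumes d: "d = 4 * a ^ 3 + 27 * b ^ 2" and w: "w ^ 2 = z ^ 3 + a * z + b"
    and x: "x ^ 4 = - 64 * d * x - 192 * a * d"
    and y: "9 * b * y = - (x ^ 3 - 4 * a * x ^ 2 + (16 * a ^ 2 - 72 * b * z) * x + 48 * d)"
  shows "(9 * b) ^ 4 * (y ^ 4 - 512 * d * y ^ 2 + 2 ^ 15 * d * w ^ 2 * y 
      + (2 ^ 16 * d * (d + w ^ 2 * (12 * a * z - 36 * b))
          + 2 ^ 18 * d * (27 * b * z ^ 3 - 9 * a ^ 2 * z ^ 2 - a ^ 3))) = 0"
proof -
  define T where "T = 48 * d + (16 * a ^ 2 - 72 * b * z) * x + (- 4 * a) * x ^ 2 + 1 * x ^ 3"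
  have yT: "9 * b * y = - T" using y by (simp add: T_def algebra_simps)
  have x': "x ^ 4 = (- 64 * d) * x + (- 192 * a * d)" using x by simp
  define e where "e = 16 * a ^ 2 - 72 * b * z"
  define u v where "u = - 64 * d" and "v = - 192 * a * d"
  \<comment> \<open>These are the reduced coefficients of T^2, from \<open>quartic_square\<close>
    with c0 = 48 d, c1 = e, c2 = -4 a, c3 = 1.\<close>
  define r0 r1 r2 r3 where
   "r0 = (48 * d) ^ 2 + v * (16 * a ^ 2 + 2 * e)" and
   "r1 = 96 * d * e + u * (16 * a ^ 2 + 2 * e) - 8 * a * v" and
   "r2 = e ^ 2 - 384 * a * d - 8 * a * u + v" and
   "r3 = 96 * d - 8 * a * e + u"
  have T2: "T ^ 2 = r0 + r1 * x + r2 * x ^ 2 + r3 * x ^ 3"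
    unfolding T_def quartic_square[OF x'] r0_def r1_def r2_def r3_def e_def u_def v_def
    by (simp add: algebra_simps power2_eq_square)
  have T4: "T ^ 4 = 
    (r0 ^ 2 + v * (r2 ^ 2 + 2 * r1 * r3))
    + (2 * r0 * r1 + u * (r2 ^ 2 + 2 * r1 * r3) + v * 2 * r2 * r3) * x
    + (r1 ^ 2 + 2 * r0 * r2 + u * 2 * r2 * r3 + v * r3 ^ 2) * x ^ 2
    + (2 * r0 * r3 + 2 * r1 * r2 + u * r3 ^ 2) * x ^ 3"
    using quartic_square[OF x', of r0 r1 r2 r3] T2 unfolding u_def v_def
    by (metis power2_eq_square power4_eq_xxxx mult.assoc)
  define k where "k = (2 ^ 16 * d * (d + w ^ 2 * (12 * a * z - 36 * b))
          + 2 ^ 18 * d * (27 * b * z ^ 3 - 9 * a ^ 2 * z ^ 2 - a ^ 3))"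
  \<comment> \<open>The powers of 9 b are distributed so that \<open>y\<close> occurs only in the
    product 9 b y.\<close>
  have "(9 * b) ^ 4 * (y ^ 4 - 512 * d * y ^ 2 + 2 ^ 15 * d * w ^ 2 * y + k)
    = (9 * b * y) ^ 4 - 512 * d * (9 * b) ^ 2 * (9 * b * y) ^ 2 
     + 2 ^ 15 * d * w ^ 2 * (9 * b) ^ 3 * (9 * b * y) + (9 * b) ^ 4 * k"
    by (simp add: algebra_simps eval_nat_numeral)
  also have "\<dots> = T ^ 4 - 512 * d * (9 * b) ^ 2 * T ^ 2 
     - 2 ^ 15 * d * w ^ 2 * (9 * b) ^ 3 * T + (9 * b) ^ 4 * k"
    unfolding yT by simp
  also have "\<dots> = 
    (r0 ^ 2 + v * (r2 ^ 2 + 2 * r1 * r3) - 512 * d * (9 * b) ^ 2 * r0 - 2 ^ 15 * d * w ^ 2 * (9 * b) ^ 3 * (48 * d) + (9 * b) ^ 4 * k)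
    + (2 * r0 * r1 + u * (r2 ^ 2 + 2 * r1 * r3) + v * 2 * r2 * r3 - 512 * d * (9 * b) ^ 2 * r1 - 2 ^ 15 * d * w ^ 2 * (9 * b) ^ 3 * e) * x
    + (r1 ^ 2 + 2 * r0 * r2 + u * 2 * r2 * r3 + v * r3 ^ 2 - 512 * d * (9 * b) ^ 2 * r2 - 2 ^ 15 * d * w ^ 2 * (9 * b) ^ 3 * (- 4 * a)) * x ^ 2
    + (2 * r0 * r3 + 2 * r1 * r2 + u * r3 ^ 2 - 512 * d * (9 * b) ^ 2 * r3 - 2 ^ 15 * d * w ^ 2 * (9 * b) ^ 3) * x ^ 3"
    (is "_ = ?q0 + ?q1 * x + ?q2 * x ^ 2 + ?q3 * x ^ 3")
    unfolding T2 T4 unfolding T_def e_def by (simp add: algebra_simps)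
  finally have 1: "(9 * b) ^ 4 * (y ^ 4 - 512 * d * y ^ 2 + 2 ^ 15 * d * w ^ 2 * y + k)
     = ?q0 + ?q1 * x + ?q2 * x ^ 2 + ?q3 * x ^ 3" .
  have "?q3 = 0"
    unfolding r0_def r1_def r2_def r3_def u_def v_def e_def w d by (simp add: algebra_simps eval_nat_numeral)
  moreover have "?q2 = 0"
    unfolding r0_def r1_def r2_def r3_def u_def v_def e_def w d by (simp add: algebra_simps eval_nat_numeral)
  moreover have "?q1 = 0"
    unfolding r0_def r1_def r2_def r3_def u_def v_def e_def w d by (simp add: algebra_simps eval_nat_numeral)
  moreover have "?q0 = 0"
    unfolding r0_def r1_def r2_def r3_def u_def v_def e_def w k_def d by (simp add: algebra_simps eval_nat_numeral)
  ultimately show ?thesis using 1 unfolding k_def by simp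
qed

text \<open>
  Comes from eliminating \<open>x\<^sup>2\<close> and \<open>x\<^sup>3\<close> among \<open>x\<close>, \<open>x y\<close>, \<open>y\<close>, \<open>y\<^sup>2\<close> modulo the quartic; it expresses a
  root \<open>x\<close> of \<open>g\<close> rationally in terms of \<open>y = - 9 b \<beta> - 48 d\<close>.
\<close>

lemma inverse_identity:
  fixes a b z d x :: "'a::field_char_0"
  assumes d: "d = 4 * a ^ 3 + 27 * b ^ 2"
    and x: "x ^ 4 = - 64 * d * x - 192 * a * d"
    and e: "e = 16 * a ^ 2 - 72 * b * z"
    and y: "y = x ^ 3 - 4 * a * x ^ 2 + e * x"
    and t: "t = 24 * b * (3 * z ^ 2 + a)"
    and p: "p = (- 64 * d - 8 * a * e) * z - 4 * a * t"
    and s: "s = p * e + 16 * d * z * (8 * e - 32 * a ^ 2) + 64 * d * t"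
  shows "(s + t * y) * x = - 192 * a * d * (t + z * (16 * a ^ 2 + 2 * e)) + p * y - z * y ^ 2"
proof -
  define u v where "u = - 64 * d" and "v = - 192 * a * d"
  have x': "x ^ 4 = u * x + v" using x by (simp add: u_def v_def)
  have y2: "y ^ 2 = v * (16 * a ^ 2 + 2 * e) 
    + (u * (16 * a ^ 2 + 2 * e) - 8 * a * v) * x
    + (e ^ 2 - 8 * a * u + v) * x ^ 2 + (u - 8 * a * e) * x ^ 3"
    using quartic_square[OF x', of 0 e "- 4 * a" 1] unfolding y
    by (simp add: algebra_simps)
  have yx: "y * x = v + u * x + e * x ^ 2 - 4 * a * x ^ 3"
    using x' unfolding y by (simp add: algebra_simps eval_nat_numeral)
  \<comment> \<open>The choices of \<open>p\<close>, \<open>s\<close> and the constant on the right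
    cancel x^3, x and 1 in the claim; this is the coefficient left at x^2. It vanishes because e -
    16 a^2 = -72 b z and e^2 - 32 a^2 e + 64 a d = 1728 b^2 (3 z^2 + a), which explains the formula
    for \<open>t\<close>.\<close>
  have c2: "t * (e - 16 * a ^ 2) + z * (e ^ 2 - 32 * a ^ 2 * e + 64 * a * d) = 0"
    unfolding e t d by (simp add: algebra_simps eval_nat_numeral)
  have "(s + t * y) * x - (- 192 * a * d * (t + z * (16 * a ^ 2 + 2 * e)) + p * y - z * y ^ 2)
    = s * x + t * (y * x) - (- 192 * a * d * (t + z * (16 * a ^ 2 + 2 * e)) + p * y - z * y ^ 2)"
    by (simp add: algebra_simps)
  also have "\<dots> = (t * (e - 16 * a ^ 2) + z * (e ^ 2 - 32 * a ^ 2 * e + 64 * a * d)) * x ^ 2"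
    unfolding y2 yx unfolding y s p u_def v_def by (simp add: algebra_simps eval_nat_numeral)
  finally show ?thesis unfolding c2 by simp
qed

section \<open>The element \<beta> as a root of h_1\<close>

lemma beta_of_eq:
  assumes "b \<noteq> 0"
  shows "9 * of_rat b * beta_of a b z \<alpha> = - (\<alpha> ^ 3 - 4 * of_rat a * \<alpha> ^ 2
    + (16 * of_rat a ^ 2 - 72 * of_rat b * of_rat z) * \<alpha> + 48 * of_rat (curve_d a b))"
  using assms
  by (simp add: beta_of_def of_rat_mult of_rat_diff of_rat_power of_rat_divide of_rat_minus field_simps)

lemma rat_eval_g_poly:
  "rat_eval x (g_poly a b) =
    x ^ 4 + 64 * of_rat (curve_d a b) * x + 192 * of_rat a * of_rat (curve_d a b)"
  by (simp add: g_poly_def curve_Delta_def of_rat_mult of_rat_minus algebra_simps eval_nat_numeral)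

lemma degree_g_poly [simp]: "degree (g_poly a b) = 4"
  by (simp add: g_poly_def)

lemma of_rat_curve_d: "of_rat (curve_d a b) = 4 * of_rat a ^ 3 + 27 * of_rat b ^ 2"
  by (simp add: curve_d_def of_rat_add of_rat_mult of_rat_power)

lemma rat_root_h1_poly_beta_of:
  assumes "b \<noteq> 0" "w ^ 2 = z ^ 3 + a * z + b" "rat_root (g_poly a b) \<alpha>"
  shows "rat_root (h1_poly a b z w) (beta_of a b z \<alpha>)"
proof -
  let ?d = "of_rat (curve_d a b)" and ?y = "beta_of a b z \<alpha>"
  have x: "\<alpha> ^ 4 = - 64 * ?d * \<alpha> - 192 * of_rat a * ?d"
    using assms(3) by (simp add: rat_root_iff rat_eval_g_poly algebra_simps add_eq_0_iff2)
  have w: "of_rat w ^ 2 = of_rat z ^ 3 + of_rat a * of_rat z + (of_rat b :: 'a)"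
    using arg_cong[OF assms(2), of of_rat] by (simp add: of_rat_add of_rat_mult of_rat_power)
  have "rat_eval ?y (h1_poly a b z w) =
    ?y ^ 4 - 512 * ?d * ?y ^ 2 + 2 ^ 15 * ?d * of_rat w ^ 2 * ?y
      + (2 ^ 16 * ?d * (?d + of_rat w ^ 2 * (12 * of_rat a * of_rat z - 36 * of_rat b))
          + 2 ^ 18 * ?d * (27 * of_rat b * of_rat z ^ 3 - 9 * of_rat a ^ 2 * of_rat z ^ 2 - of_rat a ^ 3))"
    by (simp add: h1_poly_def Let_def of_rat_add of_rat_mult of_rat_minus of_rat_diff of_rat_power
        algebra_simps power4_eq_xxxx power2_eq_square)
  moreover have "(9 * of_rat b :: 'a) ^ 4 \<noteq> 0"
    using assms(1) by simp
  ultimately show ?thesis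
    using h1_identity[OF of_rat_curve_d w x beta_of_eq[OF assms(1)]]
    by (simp add: rat_root_iff)
qed

section \<open>Recovering \<alpha> from \<beta>\<close>

lemma g_poly_irreducible_imp_a_nonzero:
  assumes "Factorial_Ring.irreducible (g_poly a b)"
  shows "a \<noteq> 0"
proof
  assume "a = 0"
  then have "g_poly a b = [:0, 1:] * [:- 4 * curve_Delta a b, 0, 0, 1:]"
    by (simp add: g_poly_def)
  with assms have "[:0, 1:] dvd (1 :: rat poly) \<or> [:- 4 * curve_Delta a b, 0, 0, 1:] dvd 1"
    using irreducibleD by blast
  then show False
    by (simp add: is_unit_iff_degree)
qed

text \<open>Vanishing of \<open>t\<close> means that the derivative 3 x^2 + a of the cubic is zero
  at \<open>z\<close>. Then \<open>s\<close> is a nonzero constant times b^2 z^2 (2 z^3 - b), and b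
  = 2 z^3 would make \<open>z\<close> a double root of the cubic, so d = 0.\<close>

lemma inverse_coefficients_nonzero:
  fixes a b z :: rat
  assumes "curve_d a b \<noteq> 0" "a \<noteq> 0" "b \<noteq> 0"
    and e: "e = 16 * a ^ 2 - 72 * b * z"
    and t: "t = 24 * b * (3 * z ^ 2 + a)"
    and p: "p = (- 64 * curve_d a b - 8 * a * e) * z - 4 * a * t"
    and s: "s = p * e + 16 * curve_d a b * z * (8 * e - 32 * a ^ 2) + 64 * curve_d a b * t"
  shows "s \<noteq> 0 \<or> t \<noteq> 0"
proof (rule ccontr)
  assume "\<not> ?thesis"
  then have "s = 0" "t = 0" by auto
  then have a: "a = - 3 * z ^ 2"
    using assms(3) t by (simp add: add_eq_0_iff)
  have "s = z * 4 * 432 * b ^ 2 * (72 * z * (2 * z ^ 3 - b))"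
    unfolding s p \<open>t = 0\<close> unfolding e curve_d_def a by (simp add: algebra_simps eval_nat_numeral)
  moreover have "z \<noteq> 0" using assms(2) a by auto
  ultimately have "b = 2 * z ^ 3" using \<open>s = 0\<close> assms(3) by simp
  then have "curve_d a b = 0"
    unfolding curve_d_def a by (simp add: power_mult_distrib flip: power_mult)
  with assms(1) show False by simp
qed

text \<open>The polynomial \<open>f\<close> only makes Q[\<beta>] closed under division. It is left
  arbitrary because the result is first applied before h_1 is known to be irreducible.\<close>

lemma root_in_range_rat_eval_beta_of:
  assumes "curve_d a b \<noteq> 0" "b \<noteq> 0" "rat_root (g_poly a b) \<alpha>"
    and irr: "Factorial_Ring.irreducible (g_poly a b)"
    and f: "Factorial_Ring.irreducible f" "rat_eval (beta_of a b z \<alpha>) f = 0"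
  shows "\<alpha> \<in> range (rat_eval (beta_of a b z \<alpha>))"
proof -
  let ?\<beta> = "beta_of a b z \<alpha>"
  define d where "d = curve_d a b"
  define e where "e = 16 * a ^ 2 - 72 * b * z"
  define t where "t = 24 * b * (3 * z ^ 2 + a)"
  define p where "p = (- 64 * d - 8 * a * e) * z - 4 * a * t"
  define s where "s = p * e + 16 * d * z * (8 * e - 32 * a ^ 2) + 64 * d * t"
  define r where "r = - 192 * a * d * (t + z * (16 * a ^ 2 + 2 * e))"
  define y where "y = \<alpha> ^ 3 - 4 * of_rat a * \<alpha> ^ 2 + of_rat e * \<alpha>"
  note hom = of_rat_add of_rat_mult of_rat_power of_rat_diff of_rat_minus
  have root: "rat_eval \<alpha> (g_poly a b) = 0" using assms(3) by (simp add: rat_root_iff)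
  then have x: "\<alpha> ^ 4 = - 64 * of_rat d * \<alpha> - 192 * of_rat a * of_rat d"
    by (simp add: rat_eval_g_poly d_def algebra_simps add_eq_0_iff2)
  have "(of_rat s + of_rat t * y) * \<alpha> = of_rat r + of_rat p * y - of_rat z * y ^ 2"
    using inverse_identity[OF of_rat_curve_d[of a b, folded d_def] x _ y_def,
        where z = "of_rat z" and t = "of_rat t" and p = "of_rat p" and s = "of_rat s"]
    by (simp add: hom r_def e_def t_def p_def s_def)
  moreover have y: "y = rat_eval ?\<beta> [:- 48 * d, - 9 * b:]"
    using beta_of_eq[OF assms(2), of a z \<alpha>]
    by (simp add: y_def e_def d_def hom algebra_simps)
  \<comment> \<open>Written out in \<alpha>, the denominator has degree at most 3, so it can vanish
    only if all its coefficients do, g being irreducible of degree 4.\<close>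
  moreover have "of_rat s + of_rat t * y \<noteq> 0"
  proof
    assume "of_rat s + of_rat t * y = 0"
    moreover have "rat_eval \<alpha> [:s, t * e, - 4 * a * t, t:] = of_rat s + of_rat t * y"
      by (simp add: y_def hom algebra_simps eval_nat_numeral)
    ultimately have "rat_eval \<alpha> [:s, t * e, - 4 * a * t, t:] = 0"
      by metis
    then have "g_poly a b dvd [:s, t * e, - 4 * a * t, t:]"
      by (rule rat_eval_eq_0_iff_dvd[OF irr root, THEN iffD1])
    moreover have "degree [:s, t * e, - 4 * a * t, t:] < degree (g_poly a b)"
      by (auto simp: degree_pCons_eq_if)
    ultimately have "[:s, t * e, - 4 * a * t, t:] = 0"
      by (meson dvd_imp_degree_le not_le)
    then have "s = 0 \<and> t = 0"
      by (metis pCons_eq_0_iff)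
    then show False
      using inverse_coefficients_nonzero[OF assms(1) g_poly_irreducible_imp_a_nonzero[OF irr]
          assms(2) e_def t_def p_def[unfolded d_def] s_def[unfolded d_def]]
      by simp
  qed
  ultimately have "\<alpha> = (of_rat r + of_rat p * y - of_rat z * y ^ 2) / (of_rat s + of_rat t * y)"
    by (simp add: field_simps)
  also have "of_rat s + of_rat t * y = rat_eval ?\<beta> ([:s:] + smult t [:- 48 * d, - 9 * b:])"
    unfolding rat_eval_add rat_eval_smult y by simp
  also have "of_rat r + of_rat p * y - of_rat z * y ^ 2 = rat_eval ?\<beta>
      ([:r:] + smult p [:- 48 * d, - 9 * b:] - smult z ([:- 48 * d, - 9 * b:] ^ 2))"
    unfolding rat_eval_add rat_eval_diff rat_eval_smult rat_eval_power y by simp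
  finally show ?thesis
    using rat_eval_divide_in_range[OF f]
    by (rule ssubst[where P = "\<lambda>v. v \<in> range (rat_eval ?\<beta>)"])
qed

section \<open>Irreducibility of h_1 and the isomorphism\<close>

text \<open>An irreducible \<open>f\<close> killing \<beta>, of degree at most that of
  \<open>m\<close>, puts \<alpha> in Q[\<beta>]. The dimension bound then yields a nonzero
  polynomial of no larger degree killing \<alpha>, and g divides it.\<close>

lemma degree_ge_4_if_rat_eval_beta_of_eq_0:
  assumes "curve_d a b \<noteq> 0" "b \<noteq> 0" "rat_root (g_poly a b) \<alpha>"
    and irr: "Factorial_Ring.irreducible (g_poly a b)"
    and m: "m \<noteq> 0" "rat_eval (beta_of a b z \<alpha>) m = 0"
  shows "degree m \<ge> 4"
proof -
  obtain f where f: "Factorial_Ring.irreducible f" "rat_eval (beta_of a b z \<alpha>) f = 0"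
      "degree f \<le> degree m"
    using ex_irreducible_rat_eval_eq_0[OF m] by blast
  then have "f \<noteq> 0" by auto
  obtain q where q: "q \<noteq> 0" "rat_eval \<alpha> q = 0" "degree q \<le> degree f"
    using ex_rat_eval_eq_0_degree_le[OF \<open>f \<noteq> 0\<close> f(2)
        root_in_range_rat_eval_beta_of[OF assms(1-4) f(1,2)]] by blast
  then have "g_poly a b dvd q"
    using rat_eval_eq_0_iff_dvd[OF irr] assms(3) unfolding rat_root_iff by blast
  then have "4 \<le> degree q"
    using dvd_imp_degree_le[OF _ q(1)] by fastforce
  with q f show ?thesis by simp
qed

text \<open>In a factorisation of h_1 one factor kills \<beta> and so takes up the whole degree 4;
  the other is constant.\<close>

lemma irreducible_h1_poly:
  assumes "curve_d a b \<noteq> 0" "b \<noteq> 0" "w ^ 2 = z ^ 3 + a * z + b" "rat_root (g_poly a b) \<alpha>"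
    and irr: "Factorial_Ring.irreducible (g_poly a b)"
  shows "Factorial_Ring.irreducible (h1_poly a b z w)"
proof (rule irreducibleI)
  let ?\<beta> = "beta_of a b z \<alpha>"
  have deg: "degree (h1_poly a b z w) = 4"
    by (simp add: h1_poly_def Let_def)
  then show "h1_poly a b z w \<noteq> 0" by auto
  then show "\<not> h1_poly a b z w dvd 1"
    using deg by (simp add: is_unit_iff_degree)
  fix p q
  assume pq: "h1_poly a b z w = p * q"
  then have nz: "p \<noteq> 0" "q \<noteq> 0" using deg by auto
  then have "degree p + degree q = 4"
    using deg pq by (simp add: degree_mult_eq)
  moreover have "rat_eval ?\<beta> p = 0 \<or> rat_eval ?\<beta> q = 0"
    using rat_root_h1_poly_beta_of[OF assms(2-4)] pq by (simp add: rat_root_iff)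
  then have "degree p \<ge> 4 \<or> degree q \<ge> 4"
    using degree_ge_4_if_rat_eval_beta_of_eq_0[OF assms(1,2,4) irr] nz by blast
  ultimately show "p dvd 1 \<or> q dvd 1"
    using nz by (auto simp: is_unit_iff_degree)
qed

text \<open>For irreducible g no ring homomorphism sends \<alpha> to \<beta>, since g and h_1 differ
  in the coefficient -512 d of x^2. The isomorphism is therefore stated as \<gamma> \<mapsto>
  \<beta>, from the field of an arbitrary root \<gamma> of h_1 onto Q(\<alpha>), together with
  Q(\<beta>) = Q(\<alpha>).\<close>

theorem mainTheorem3:
  fixes a b z w :: rat
    and P :: "(rat \<times> rat) option"
    and \<alpha> :: "'k::field_char_0"
  assumes "is_elliptic_curve a b"
    and "b \<noteq> 0"
    and "P \<in> rational_points a b - {None}"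
    and "P = Some (z, w)"
    and "rat_root (g_poly a b) \<alpha>"
  shows "rat_root (h1_poly a b z w) (beta_of a b z \<alpha>) \<and>
    (Factorial_Ring.irreducible (g_poly a b) \<longrightarrow>
       carrier (rat_adjoin (beta_of a b z \<alpha>)) = carrier (rat_adjoin \<alpha>) \<and>
       (\<forall>\<gamma> :: 'l::field_char_0. rat_root (h1_poly a b z w) \<gamma> \<longrightarrow>
          (\<exists>\<phi> \<in> ring_iso (rat_adjoin \<gamma>) (rat_adjoin \<alpha>). \<phi> \<gamma> = beta_of a b z \<alpha>)))"
proof -
  let ?\<beta> = "beta_of a b z \<alpha>"
  have d: "curve_d a b \<noteq> 0"
    using assms(1) by (simp add: is_elliptic_curve_def curve_Delta_def)
  have w: "w ^ 2 = z ^ 3 + a * z + b"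
    using assms(3,4) by (auto simp: rational_points_def)
  have h1: "rat_root (h1_poly a b z w) ?\<beta>"
    by (rule rat_root_h1_poly_beta_of[OF assms(2) w assms(5)])
  show ?thesis
  proof (intro conjI impI allI h1)
    assume irr: "Factorial_Ring.irreducible (g_poly a b)"
    have irr': "Factorial_Ring.irreducible (h1_poly a b z w)"
      by (rule irreducible_h1_poly[OF d assms(2) w assms(5) irr])
    have \<alpha>: "rat_eval \<alpha> (g_poly a b) = 0" and \<beta>: "rat_eval ?\<beta> (h1_poly a b z w) = 0"
      using assms(5) h1 by (simp_all add: rat_root_iff)
    have "?\<beta> = rat_eval \<alpha> (smult (- 1 / (3 ^ 2 * b))
        [:2 ^ 4 * 3 * curve_d a b, 16 * a ^ 2 - 72 * b * z, - (4 * a), 1:])"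
      unfolding beta_of_def rat_eval_smult
      by (simp add: of_rat_minus algebra_simps eval_nat_numeral)
    then obtain p where p: "?\<beta> = rat_eval \<alpha> p" by blast
    obtain q where q: "\<alpha> = rat_eval ?\<beta> q"
      using root_in_range_rat_eval_beta_of[OF d assms(2,5) irr irr' \<beta>] by blast
    show eq: "carrier (rat_adjoin ?\<beta>) = carrier (rat_adjoin \<alpha>)"
      unfolding carrier_rat_adjoin[OF irr \<alpha>] carrier_rat_adjoin[OF irr' \<beta>]
      using range_rat_eval_subset[of ?\<beta> \<alpha>] range_rat_eval_subset[of \<alpha> ?\<beta>] p q
      by (metis rangeI subset_antisym)
    fix \<gamma> :: 'l
    assume "rat_root (h1_poly a b z w) \<gamma>"
    then have "\<exists>\<phi> \<in> ring_iso (rat_adjoin \<gamma>) (rat_adjoin ?\<beta>). \<phi> \<gamma> = ?\<beta>"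
      using rat_adjoin_iso[OF irr' _ \<beta>] by (simp add: rat_root_iff)
    \<comment> \<open>The ring \<open>rat_adjoin x\<close> depends on \<open>x\<close> only through
      its carrier, so equal carriers give equal rings.\<close>
    then show "\<exists>\<phi> \<in> ring_iso (rat_adjoin \<gamma>) (rat_adjoin \<alpha>). \<phi> \<gamma> = ?\<beta>"
      using eq by (simp add: rat_adjoin_def)
  qed
qed

end
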